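(* Let $d \ge 2$. There is an algorithm that, given a set of $n$ points in the unit hypercube $[0,1]^d$, computes in $O(n + d\log d)$ time an empty box of volume at least $$\frac{\log d}{4(n+\log d)}.$$
   Context: A box in $\mathbb{R}^d$ is an open axis-parallel hyperrectangle $(a_1,b_1)\times\cdots\times(a_d,b_d)$ with $a_i<b_i$ for $1\le i\le d$. Given a set $S$ of $n$ points in $[0,1]^d$, an empty box is a box contained in $[0,1]^d$ that contains no point of $S$. Here $\log$ denotes the logarithm in base $2$. Running time is counted in the usual random-access model of computational geometry: any coordinate of any input point can be accessed in constant time, and arithmetic operations, comparisons and the integer floor function on reals take constant time. The constant in the $O$-notation is absolute. *)

theory Defs
  imports "HOL-Analysis.Analysis"
begin

section \<open>Boxes in the unit cube\<close>

text \<open>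
  The dimension \<open>d\<close> is an input of the algorithm, so it is a natural number rather than a type.
  Points of \<open>d\<close>-space are the extensional functions on \<open>{..<d}\<close>, and volume is the product
  Lebesgue measure on them.
\<close>

type_synonym point = "nat \<Rightarrow> real"

definition unit_cube :: "nat \<Rightarrow> point set" where
  "unit_cube d = (\<Pi>\<^sub>E i\<in>{..<d}. {0..1})"

definition open_box :: "nat \<Rightarrow> (nat \<Rightarrow> real) \<Rightarrow> (nat \<Rightarrow> real) \<Rightarrow> point set" where
  "open_box d a b = (\<Pi>\<^sub>E i\<in>{..<d}. {a i<..<b i})"

definition empty_box :: "nat \<Rightarrow> point set \<Rightarrow> (nat \<Rightarrow> real) \<Rightarrow> (nat \<Rightarrow> real) \<Rightarrow> bool" where
  "empty_box d S a b \<longleftrightarrow>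
     (\<forall>i<d. a i < b i) \<and> open_box d a b \<subseteq> unit_cube d \<and> open_box d a b \<inter> S = {}"

definition box_volume :: "nat \<Rightarrow> point set \<Rightarrow> real" where
  "box_volume d B = measure (\<Pi>\<^sub>M i\<in>{..<d}. (lborel :: real measure)) B"


section \<open>A unit-cost real random-access machine\<close>

text \<open>
  A state consists of a register file, whose registers are named in the program text, and a
  memory, whose cells are addressed indirectly through registers. Registers and memory cells hold
  real numbers. The input points are kept in a separate read-only store, from which a single
  coordinate of a single point can be read in one step.

  The only constants a program may contain are integers; arbitrary real constants could encode an
  infinite amount of advice.
\<close>

type_synonym reg = nat
type_synonym state = "(reg \<Rightarrow> real) \<times> (nat \<Rightarrow> real)"

datatype arith = Plus | Minus | Times | Divide

datatype instr =
    Const reg int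
  | Move reg reg
  | Arith arith reg reg reg
  | Floor reg reg
  | Load reg reg
  | Store reg reg
  | Input reg reg reg

datatype test = Less reg reg | LessEq reg reg | Equal reg reg

datatype program =
    Skip
  | Instr instr
  | Seq program program
  | Cond test program program
  | While test program

fun arith_val :: "arith \<Rightarrow> real \<Rightarrow> real \<Rightarrow> real" where
  "arith_val Plus u v = u + v"
| "arith_val Minus u v = u - v"
| "arith_val Times u v = u * v"
| "arith_val Divide u v = u / v"

fun test_val :: "test \<Rightarrow> (reg \<Rightarrow> real) \<Rightarrow> bool" where
  "test_val (Less x y) r \<longleftrightarrow> r x < r y"
| "test_val (LessEq x y) r \<longleftrightarrow> r x \<le> r y"
| "test_val (Equal x y) r \<longleftrightarrow> r x = r y"

text \<open>
  \<open>step n d p c s s'\<close>: instruction \<open>c\<close> leads from state \<open>s\<close> to state \<open>s'\<close> when the input consists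
  of the \<open>n\<close> points \<open>p 0, \<dots>, p (n - 1)\<close> in dimension \<open>d\<close>. The machine is stuck on division by
  zero, on addresses that are not natural numbers, and on input accesses out of range.
\<close>

inductive step :: "nat \<Rightarrow> nat \<Rightarrow> (nat \<Rightarrow> point) \<Rightarrow> instr \<Rightarrow> state \<Rightarrow> state \<Rightarrow> bool"
  for n d :: nat and p :: "nat \<Rightarrow> point"
where
  Const: "step n d p (Const x k) (r, m) (r(x := of_int k), m)"
| Move: "step n d p (Move x y) (r, m) (r(x := r y), m)"
| Arith: "(f = Divide \<Longrightarrow> r z \<noteq> 0) \<Longrightarrow>
    step n d p (Arith f x y z) (r, m) (r(x := arith_val f (r y) (r z)), m)"
| Floor: "step n d p (Floor x y) (r, m) (r(x := of_int \<lfloor>r y\<rfloor>), m)"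
| Load: "r y = of_nat k \<Longrightarrow> step n d p (Load x y) (r, m) (r(x := m k), m)"
| Store: "r x = of_nat k \<Longrightarrow> step n d p (Store x y) (r, m) (r, m(k := r y))"
| Input: "r y = of_nat i \<Longrightarrow> i < n \<Longrightarrow> r z = of_nat j \<Longrightarrow> j < d \<Longrightarrow>
    step n d p (Input x y z) (r, m) (r(x := p i j), m)"

text \<open>
  \<open>exec n d p c s t s'\<close>: program \<open>c\<close> started in \<open>s\<close> halts in \<open>s'\<close> after time \<open>t\<close>, where every
  instruction and every evaluation of a test takes one unit of time.
\<close>

inductive exec ::
  "nat \<Rightarrow> nat \<Rightarrow> (nat \<Rightarrow> point) \<Rightarrow> program \<Rightarrow> state \<Rightarrow> nat \<Rightarrow> state \<Rightarrow> bool"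
  for n d :: nat and p :: "nat \<Rightarrow> point"
where
  Skip: "exec n d p Skip s 1 s"
| Instr: "step n d p c s s' \<Longrightarrow> exec n d p (Instr c) s 1 s'"
| Seq: "exec n d p c1 s t1 s' \<Longrightarrow> exec n d p c2 s' t2 s'' \<Longrightarrow>
    exec n d p (Seq c1 c2) s (t1 + t2) s''"
| CondTrue: "test_val b (fst s) \<Longrightarrow> exec n d p c1 s t s' \<Longrightarrow>
    exec n d p (Cond b c1 c2) s (1 + t) s'"
| CondFalse: "\<not> test_val b (fst s) \<Longrightarrow> exec n d p c2 s t s' \<Longrightarrow>
    exec n d p (Cond b c1 c2) s (1 + t) s'"
| WhileFalse: "\<not> test_val b (fst s) \<Longrightarrow> exec n d p (While b c) s 1 s"
| WhileTrue: "test_val b (fst s) \<Longrightarrow> exec n d p c s t1 s' \<Longrightarrow>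
    exec n d p (While b c) s' t2 s'' \<Longrightarrow> exec n d p (While b c) s (1 + t1 + t2) s''"

text \<open>
  The machine is deterministic, so that the existence of a halting execution is a statement about
  the unique run of the program.
\<close>

lemma step_deterministic: "step n d p c s s1 \<Longrightarrow> step n d p c s s2 \<Longrightarrow> s1 = s2"
  by (induction rule: step.induct; erule step.cases; simp)

lemma exec_deterministic:
  "exec n d p c s t1 s1 \<Longrightarrow> exec n d p c s t2 s2 \<Longrightarrow> t1 = t2 \<and> s1 = s2"
proof (induction arbitrary: t2 s2 rule: exec.induct)
  case (Skip s)
  then show ?case by (cases rule: exec.cases) auto
next
  case (Instr c s s')
  from Instr.prems Instr.hyps show ?case
    by (cases rule: exec.cases) (auto intro: step_deterministic)
next
  case (Seq c1 s ta s' c2 tb s'')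
  from Seq.prems Seq.IH show ?case
    by (cases rule: exec.cases) blast
next
  case (CondTrue b s c1 t s' c2)
  from CondTrue.prems CondTrue.hyps(1) CondTrue.IH show ?case
    by (cases rule: exec.cases) auto
next
  case (CondFalse b s c2 t s' c1)
  from CondFalse.prems CondFalse.hyps(1) CondFalse.IH show ?case
    by (cases rule: exec.cases) auto
next
  case (WhileFalse b s c)
  from WhileFalse.prems WhileFalse.hyps show ?case
    by (cases rule: exec.cases) auto
next
  case (WhileTrue b s c ta s' tb s'')
  note IH = WhileTrue.IH
  from WhileTrue.prems show ?case
  proof (cases rule: exec.cases)
    case WhileFalse
    with WhileTrue.hyps(1) show ?thesis by simp
  next
    case (WhileTrue ta' r tb')
    then show ?thesis using IH by blast
  qed
qed

text \<open>
  Initially register 0 holds \<open>n\<close>, register 1 holds \<open>d\<close>, and everything else is zero. On halting,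
  the memory cells \<open>0, \<dots>, 2 * d - 1\<close> hold the corners of the output box in interleaved order
  \<open>a 0, b 0, a 1, b 1, \<dots>\<close>.
\<close>

definition init_state :: "nat \<Rightarrow> nat \<Rightarrow> state" where
  "init_state n d = ((\<lambda>_. 0)(0 := of_nat n, 1 := of_nat d), \<lambda>_. 0)"

definition output_lower :: "state \<Rightarrow> nat \<Rightarrow> real" where
  "output_lower s i = snd s (2 * i)"

definition output_upper :: "state \<Rightarrow> nat \<Rightarrow> real" where
  "output_upper s i = snd s (2 * i + 1)"

end

theory Submission
  imports Defs
begin

text \<open>
  Let \<open>c = \<lceil>log d\<rceil>\<close>. Cutting the cube along the first coordinate into \<open>k = \<lfloor>n / c\<rfloor> + 1\<close> slabs leaves
  some slab with fewer than \<open>c\<close> points, that is, with \<open>q\<close> points where \<open>2\<^sup>q < d\<close>. Record for each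
  coordinate which of these \<open>q\<close> points lie below the middle of the slab in that coordinate. By
  pigeonhole two coordinates \<open>i < j\<close> have the same record, so no point of the slab is below the
  middle in \<open>i\<close> and above it in \<open>j\<close>. That quarter of the slab has volume
  \<open>1 / (4k) \<ge> log d / (4 (n + log d))\<close>. Read as binary numbers below \<open>d\<close>, the records index a table
  that finds the pair in linear time; computing them takes \<open>d q \<le> d log d\<close> steps.
\<close>

section \<open>Time-bounded total correctness\<close>

text \<open>Only an upper bound on the time is kept, so that branches of different cost can share
  one bound. Executions are unique, so a single halting run already gives total correctness.\<close>

definition halts_within ::
  "nat \<Rightarrow> nat \<Rightarrow> (nat \<Rightarrow> point) \<Rightarrow> program \<Rightarrow> nat \<Rightarrow>
    ((reg \<Rightarrow> real) \<Rightarrow> (nat \<Rightarrow> real) \<Rightarrow> bool) \<Rightarrow> (reg \<Rightarrow> real) \<Rightarrow> (nat \<Rightarrow> real) \<Rightarrow> bool" where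
  "halts_within n d p c T Q r m \<longleftrightarrow>
     (\<exists>t r' m'. exec n d p c (r, m) t (r', m') \<and> t \<le> T \<and> Q r' m')"

lemma halts_within_mono:
  assumes "halts_within n d p c T Q r m" "T \<le> T'" "\<And>r' m'. Q r' m' \<Longrightarrow> Q' r' m'"
  shows "halts_within n d p c T' Q' r m"
  using assms unfolding halts_within_def by (meson le_trans)

lemma halts_within_Skip: "Q r m \<Longrightarrow> 1 \<le> T \<Longrightarrow> halts_within n d p Skip T Q r m"
  unfolding halts_within_def using exec.Skip by blast

lemma halts_within_Seq:
  assumes "halts_within n d p c1 T1 Q r m"
    and "\<And>r' m'. Q r' m' \<Longrightarrow> halts_within n d p c2 T2 R r' m'"
  shows "halts_within n d p (Seq c1 c2) (T1 + T2) R r m"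
proof -
  obtain t1 r1 m1 where 1: "exec n d p c1 (r, m) t1 (r1, m1)" "t1 \<le> T1" "Q r1 m1"
    using assms(1) unfolding halts_within_def by blast
  obtain t2 r2 m2 where 2: "exec n d p c2 (r1, m1) t2 (r2, m2)" "t2 \<le> T2" "R r2 m2"
    using assms(2)[OF 1(3)] unfolding halts_within_def by blast
  show ?thesis
    unfolding halts_within_def using exec.Seq[OF 1(1) 2(1)] 1(2) 2(2,3) add_mono by blast
qed

lemma halts_within_Cond:
  assumes "test_val b r \<Longrightarrow> halts_within n d p c1 T Q r m"
    and "\<not> test_val b r \<Longrightarrow> halts_within n d p c2 T Q r m"
  shows "halts_within n d p (Cond b c1 c2) (1 + T) Q r m"
proof (cases "test_val b r")
  case True
  then show ?thesis
    using assms(1) exec.CondTrue[of b "(r, m)"] unfolding halts_within_def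
    by (metis add_left_mono fst_conv)
next
  case False
  then show ?thesis
    using assms(2) exec.CondFalse[of b "(r, m)"] unfolding halts_within_def
    by (metis add_left_mono fst_conv)
qed

text \<open>The invariant is indexed by the number of completed rounds; reaching \<open>I N\<close>
  therefore also proves termination. Each round pays \<open>f i\<close> for the body and 1 for its
  test, and the final 1 pays for the failing test.\<close>

lemma halts_within_While:
  assumes init: "I 0 r m"
    and body: "\<And>i r m. i < N \<Longrightarrow> I i r m \<Longrightarrow>
      test_val b r \<and> halts_within n d p c (f i) (I (Suc i)) r m"
    and exit: "\<And>r m. I N r m \<Longrightarrow> \<not> test_val b r"
  shows "halts_within n d p (While b c) ((\<Sum>i<N. f i + 1) + 1) (I N) r m"
proof -
  \<comment> \<open>Generalised to the rounds still to come, so that the induction can run downwards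
    from \<open>j = N\<close>.\<close>
  have "halts_within n d p (While b c) ((\<Sum>i\<in>{j..<N}. f i + 1) + 1) (I N) r m"
    if "j \<le> N" "I j r m" for j r m
    using that
  proof (induction arbitrary: r m rule: inc_induct)
    case base
    then show ?case
      unfolding halts_within_def using exec.WhileFalse[of b "(r, m)"] exit
      by (metis atLeastLessThan_empty fst_conv le_add2 order_refl)
  next
    case (step j)
    obtain t1 r1 m1 where 1: "exec n d p c (r, m) t1 (r1, m1)" "t1 \<le> f j" "I (Suc j) r1 m1"
      using body[OF step.hyps(2) step.prems] unfolding halts_within_def by blast
    obtain t2 r2 m2 where 2: "exec n d p (While b c) (r1, m1) t2 (r2, m2)"
      "t2 \<le> (\<Sum>i\<in>{Suc j..<N}. f i + 1) + 1" "I N r2 m2"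
      using step.IH[OF 1(3)] unfolding halts_within_def by blast
    have "exec n d p (While b c) (r, m) (1 + t1 + t2) (r2, m2)"
      using exec.WhileTrue[OF _ 1(1) 2(1)] body[OF step.hyps(2) step.prems] by simp
    moreover have "1 + t1 + t2 \<le> (\<Sum>i\<in>{j..<N}. f i + 1) + 1"
      using 1(2) 2(2) step.hyps(2) by (simp add: sum.atLeast_Suc_lessThan)
    ultimately show ?case
      unfolding halts_within_def using 2(3) by blast
  qed
  from this[of 0 r m] init show ?thesis by (simp add: lessThan_atLeast0)
qed

fun block :: "instr list \<Rightarrow> program" where
  "block [] = Skip"
| "block (c # cs) = Seq (Instr c) (block cs)"

text \<open>
  A weakest precondition: an address \<open>r y\<close> is decoded by \<open>nat \<lfloor>r y\<rfloor>\<close>, which is exact under the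
  accompanying condition \<open>r y \<in> \<nat>\<close>.
\<close>

fun wp ::
  "nat \<Rightarrow> nat \<Rightarrow> (nat \<Rightarrow> point) \<Rightarrow> instr list \<Rightarrow>
    ((reg \<Rightarrow> real) \<Rightarrow> (nat \<Rightarrow> real) \<Rightarrow> bool) \<Rightarrow> (reg \<Rightarrow> real) \<Rightarrow> (nat \<Rightarrow> real) \<Rightarrow> bool" where
  "wp n d p [] Q r m = Q r m"
| "wp n d p (Const x k # cs) Q r m = wp n d p cs Q (r(x := of_int k)) m"
| "wp n d p (Move x y # cs) Q r m = wp n d p cs Q (r(x := r y)) m"
| "wp n d p (Arith f x y z # cs) Q r m =
     ((f = Divide \<longrightarrow> r z \<noteq> 0) \<and> wp n d p cs Q (r(x := arith_val f (r y) (r z))) m)"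
| "wp n d p (Floor x y # cs) Q r m = wp n d p cs Q (r(x := of_int \<lfloor>r y\<rfloor>)) m"
| "wp n d p (Load x y # cs) Q r m =
     (r y \<in> \<nat> \<and> wp n d p cs Q (r(x := m (nat \<lfloor>r y\<rfloor>))) m)"
| "wp n d p (Store x y # cs) Q r m =
     (r x \<in> \<nat> \<and> wp n d p cs Q r (m(nat \<lfloor>r x\<rfloor> := r y)))"
| "wp n d p (Input x y z # cs) Q r m =
     (r y \<in> \<nat> \<and> r y < real n \<and> r z \<in> \<nat> \<and> r z < real d \<and>
      wp n d p cs Q (r(x := p (nat \<lfloor>r y\<rfloor>) (nat \<lfloor>r z\<rfloor>))) m)"

lemma halts_within_Instr:
  "step n d p c (r, m) (r', m') \<Longrightarrow> Q r' m' \<Longrightarrow> halts_within n d p (Instr c) 1 Q r m"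
  unfolding halts_within_def using exec.Instr by blast

lemma wp_ConsE:
  assumes "wp n d p (c # cs) Q r m"
  obtains r' m' where "step n d p c (r, m) (r', m')" "wp n d p cs Q r' m'"
proof (cases c)
  case (Load x y)
  then have "step n d p c (r, m) (r(x := m (nat \<lfloor>r y\<rfloor>)), m)"
    using assms by (auto intro!: step.Load elim!: Nats_cases)
  then show ?thesis using that assms Load by auto
next
  case (Store x y)
  then have "step n d p c (r, m) (r, m(nat \<lfloor>r x\<rfloor> := r y))"
    using assms by (auto intro!: step.Store elim!: Nats_cases)
  then show ?thesis using that assms Store by auto
next
  case (Input x y z)
  then have "step n d p c (r, m) (r(x := p (nat \<lfloor>r y\<rfloor>) (nat \<lfloor>r z\<rfloor>)), m)"
    using assms by (auto intro!: step.Input elim!: Nats_cases)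
  then show ?thesis using that assms Input by auto
qed (use assms that in \<open>auto intro: step.intros\<close>)

text \<open>A block ends in \<open>Skip\<close>, which costs one unit beyond its instructions; hence
  the strict bound on the length.\<close>

lemma halts_within_block:
  "wp n d p cs Q r m \<Longrightarrow> length cs < T \<Longrightarrow> halts_within n d p (block cs) T Q r m"
proof (induction cs arbitrary: r m T)
  case Nil
  then show ?case by (simp add: block.simps halts_within_Skip)
next
  case (Cons c cs)
  from Cons.prems(1) obtain r' m' where
    s: "step n d p c (r, m) (r', m')" "wp n d p cs Q r' m'"
    by (rule wp_ConsE)
  have "halts_within n d p (Seq (Instr c) (block cs)) (1 + (T - 1)) Q r m"
    by (rule halts_within_Seq[where Q = "\<lambda>r'' m''. r'' = r' \<and> m'' = m'"])
      (use halts_within_Instr[OF s(1)] Cons.IH[OF s(2)] Cons.prems(2) in auto)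
  then show ?case using Cons.prems(2) by (simp add: block.simps)
qed


declare block.simps [simp del]

text \<open>Reverses the usual simplification: an address keeps the form \<open>real _\<close>, so
  that its membership in \<open>\<nat>\<close> and its decoding by floor are immediate.\<close>

lemma fold_of_nat_add:
  "real a + 1 = real (Suc a)" "real a + real b = real (a + b)"
  by simp_all


section \<open>The algorithm\<close>

abbreviation (input) "r_n \<equiv> 0 :: reg"
abbreviation (input) "r_d \<equiv> 1 :: reg"
abbreviation (input) "r_one \<equiv> 2 :: reg"
abbreviation (input) "r_cap \<equiv> 3 :: reg"
abbreviation (input) "r_pow \<equiv> 4 :: reg"
abbreviation (input) "r_k \<equiv> 5 :: reg"
abbreviation (input) "r_i \<equiv> 6 :: reg"
abbreviation (input) "r_x \<equiv> 7 :: reg"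
abbreviation (input) "r_v \<equiv> 8 :: reg"
abbreviation (input) "r_s \<equiv> 9 :: reg"
abbreviation (input) "r_addr \<equiv> 10 :: reg"
abbreviation (input) "r_j \<equiv> 11 :: reg"
abbreviation (input) "r_thr \<equiv> 12 :: reg"
abbreviation (input) "r_base \<equiv> 13 :: reg"
abbreviation (input) "r_zero \<equiv> 14 :: reg"
abbreviation (input) "r_two \<equiv> 15 :: reg"
abbreviation (input) "r_half \<equiv> 16 :: reg"
abbreviation (input) "r_mid \<equiv> 17 :: reg"
abbreviation (input) "r_table \<equiv> 18 :: reg"
abbreviation (input) "r_first \<equiv> 19 :: reg"
abbreviation (input) "r_lo \<equiv> 20 :: reg"
abbreviation (input) "r_hi \<equiv> 21 :: reg"

definition log_loop :: program where
  "log_loop = While (Less r_pow r_d)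
     (block [Arith Times r_pow r_pow r_two, Arith Plus r_cap r_cap r_one])"

definition count_loop :: program where
  "count_loop = While (Less r_i r_n)
     (block [Input r_x r_i r_zero, Arith Times r_x r_k r_x, Floor r_x r_x,
        Load r_v r_x, Arith Plus r_v r_v r_one, Store r_x r_v, Arith Plus r_i r_i r_one])"

definition slab_loop :: program where
  "slab_loop = While (LessEq r_cap r_v)
     (block [Arith Plus r_s r_s r_one, Load r_v r_s])"

text \<open>\<open>r_thr\<close> holds the middle of the slab during the round for coordinate 0 and
  one half from then on; the \<open>Move\<close> makes this switch.\<close>

definition append_bits_loop :: program where
  "append_bits_loop = While (Less r_j r_d)
     (Seq (block [Input r_x r_i r_j, Arith Plus r_addr r_base r_j, Load r_v r_addr,
             Arith Times r_v r_v r_two])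
     (Seq (Cond (Less r_x r_thr) (block [Arith Plus r_v r_v r_one]) Skip)
          (block [Store r_addr r_v, Move r_thr r_half, Arith Plus r_j r_j r_one])))"

definition pattern_loop :: program where
  "pattern_loop = While (Less r_i r_n)
     (Seq (block [Input r_x r_i r_zero, Arith Times r_x r_k r_x, Floor r_x r_x])
     (Seq (Cond (Equal r_x r_s)
             (Seq (block [Const r_j 0, Move r_thr r_mid]) append_bits_loop) Skip)
          (block [Arith Plus r_i r_i r_one])))"

definition lookup :: "instr list" where
  "lookup = [Arith Plus r_addr r_base r_j, Load r_v r_addr, Arith Plus r_v r_table r_v,
     Load r_x r_v]"

definition collision_loop :: program where
  "collision_loop = While (Equal r_x r_zero)
     (block ([Arith Plus r_j r_j r_one, Store r_v r_j] @ lookup))"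

text \<open>Only coordinate 0 is restricted by the slab, so the end points become 0 and 1 after the
  first round.\<close>

definition output_loop :: program where
  "output_loop = While (Less r_i r_d)
     (block [Store r_addr r_lo, Arith Plus r_addr r_addr r_one, Store r_addr r_hi,
        Arith Plus r_addr r_addr r_one, Const r_lo 0, Const r_hi 1, Arith Plus r_i r_i r_one])"

text \<open>The final block cuts the slab down to the quarter: the upper end in coordinate
  \<open>r_first\<close> becomes the middle of its interval, and the lower end in coordinate
  \<open>r_j\<close> becomes one half.\<close>

definition algorithm :: program where
  "algorithm =
     Seq (block [Const r_one 1, Const r_two 2, Const r_pow 1, Arith Divide r_half r_one r_two])
    (Seq log_loop
    (Seq (block [Arith Divide r_k r_n r_cap, Floor r_k r_k, Arith Plus r_k r_k r_one,
            Arith Plus r_base r_k r_one])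
    (Seq count_loop
    (Seq (block [Load r_v r_zero])
    (Seq slab_loop
    (Seq (block [Arith Plus r_mid r_s r_half, Arith Divide r_mid r_mid r_k, Const r_i 0])
    (Seq pattern_loop
    (Seq (block ([Const r_j 0, Arith Plus r_table r_base r_d] @ lookup))
    (Seq collision_loop
    (Seq (block [Arith Minus r_first r_x r_one, Arith Divide r_lo r_s r_k,
            Arith Plus r_hi r_s r_one, Arith Divide r_hi r_hi r_k, Const r_i 0, Const r_addr 0])
    (Seq output_loop
         (block [Arith Times r_addr r_first r_two, Load r_x r_addr,
            Arith Plus r_addr r_addr r_one, Load r_v r_addr, Arith Plus r_x r_x r_v,
            Arith Divide r_x r_x r_two, Store r_addr r_x,
            Arith Times r_addr r_j r_two, Store r_addr r_half]))))))))))))"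

section \<open>Volume of an open box\<close>

lemma box_volume_open_box:
  assumes "\<And>i. i < d \<Longrightarrow> a i \<le> b i"
  shows "box_volume d (open_box d a b) = (\<Prod>i<d. b i - a i)"
proof -
  interpret product_sigma_finite "\<lambda>_::nat. lborel :: real measure" by standard
  have "emeasure (\<Pi>\<^sub>M i\<in>{..<d}. lborel) (open_box d a b) = (\<Prod>i<d. ennreal (b i - a i))"
    unfolding open_box_def using assms by (subst emeasure_PiM) (auto intro!: prod.cong)
  also have "\<dots> = ennreal (\<Prod>i<d. b i - a i)"
    using assms by (subst prod_ennreal) auto
  finally show ?thesis
    unfolding box_volume_def measure_def using assms by (auto intro!: enn2real_ennreal prod_nonneg)
qed

section \<open>The sparse slab, the patterns and the colliding coordinates\<close>

locale points_in_cube =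
  fixes n d :: nat and p :: "nat \<Rightarrow> point"
  assumes dim: "d \<ge> 2"
    and coordinate: "\<And>i j. i < n \<Longrightarrow> j < d \<Longrightarrow> 0 \<le> p i j \<and> p i j \<le> 1"
begin

text \<open>
  In the memory, cells \<open>0, \<dots>, k\<close> hold the slab populations (cell \<open>k\<close> catches points with first
  coordinate 1), the next \<open>d\<close> cells the patterns, and the cells after that a table that maps a
  pattern to one plus the coordinate where it occurred. The output overwrites them all.
\<close>

definition cap :: nat where "cap = (LEAST c. d \<le> 2 ^ c)"

definition k :: nat where "k = n div cap + 1"

definition slab :: "nat \<Rightarrow> nat" where "slab i = nat \<lfloor>real k * p i 0\<rfloor>"

definition population :: "nat \<Rightarrow> nat" where "population a = card {i. i < n \<and> slab i = a}"

text \<open>The leftmost choice, because \<open>slab_loop\<close> scans from 0;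
  \<open>sparse_less\<close> shows that the scan stops before the extra index
  \<open>k\<close>.\<close>

definition sparse :: nat where "sparse = (LEAST a. population a < cap)"

text \<open>The middle of the slab in coordinate \<open>j\<close>.\<close>

definition threshold :: "nat \<Rightarrow> real" where
  "threshold j = (if j = 0 then (real sparse + 1 / 2) / real k else 1 / 2)"

text \<open>A binary numeral with one digit per slab point seen so far, the latest point in the
  lowest place.\<close>

fun pattern :: "nat \<Rightarrow> nat \<Rightarrow> nat" where
  "pattern 0 j = 0"
| "pattern (Suc i) j =
     (if slab i = sparse then 2 * pattern i j + (if p i j < threshold j then 1 else 0)
      else pattern i j)"

text \<open>Minimality makes this the coordinate at which the scan first meets a filled table
  entry.\<close>

definition second :: nat where
  "second = (LEAST j. \<exists>x<j. pattern n x = pattern n j)"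

definition lower :: "nat \<Rightarrow> real" where
  "lower j = (if j = 0 then real sparse / real k else 0)"

definition upper :: "nat \<Rightarrow> real" where
  "upper j = (if j = 0 then (real sparse + 1) / real k else 1)"

lemma dim_le_pow_cap: "d \<le> 2 ^ cap"
  unfolding cap_def by (rule LeastI[of _ d]) (simp add: less_imp_le)

lemma pow_less_dim: "i < cap \<Longrightarrow> 2 ^ i < d"
  unfolding cap_def using not_less_Least not_le by blast

lemma cap_pos: "0 < cap"
  using dim_le_pow_cap dim by (cases cap) auto

lemma cap_le: "cap \<le> d"
  unfolding cap_def by (rule Least_le) (simp add: less_imp_le)

lemma k_pos: "0 < k"
  unfolding k_def by simp

lemma k_le: "k \<le> n + 1"
  unfolding k_def by simp

lemma log_le_cap: "log 2 (real d) \<le> real cap"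
proof -
  have "real d \<le> 2 ^ cap"
    using dim_le_pow_cap by (metis of_nat_le_iff of_nat_numeral of_nat_power)
  then show ?thesis
    using dim by (simp add: log_le_iff powr_realpow)
qed

text \<open>By minimality of \<open>cap\<close>, the power \<open>2 ^ (cap - 1)\<close> is still
  below \<open>d\<close>. This later charges the at most \<open>cap - 1\<close> slab points to
  \<open>log 2 d\<close>.\<close>

lemma cap_less: "real cap - 1 < log 2 (real d)"
proof -
  have "real (2 ^ (cap - 1)) < real d"
    using pow_less_dim[of "cap - 1"] cap_pos by (simp del: of_nat_power)
  then show ?thesis
    using dim cap_pos by (simp add: less_log_iff powr_realpow[symmetric] of_nat_diff Suc_le_eq)
qed

lemma slab_nonneg: "i < n \<Longrightarrow> 0 \<le> real k * p i 0"
  using coordinate[of i 0] dim by simp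

lemma real_slab: "i < n \<Longrightarrow> real_of_int \<lfloor>real k * p i 0\<rfloor> = real (slab i)"
  unfolding slab_def using slab_nonneg[of i] by simp

lemma slab_le: "i < n \<Longrightarrow> slab i \<le> k"
proof -
  assume "i < n"
  then have "real k * p i 0 \<le> real k"
    using coordinate[of i 0] dim k_pos by (simp add: mult_left_le)
  then show ?thesis unfolding slab_def by linarith
qed

lemma population_eq_0: "k < a \<Longrightarrow> population a = 0"
  unfolding population_def using slab_le by fastforce

text \<open>Averaging: \<open>k\<close> slabs with \<open>cap\<close> points each would need
  \<open>k * cap\<close> points, which exceeds \<open>n\<close>. Points with first coordinate 1 have
  index \<open>k\<close> and fall outside the union, so its cardinality is only bounded by
  \<open>n\<close>.\<close>

lemma ex_sparse: "\<exists>a<k. population a < cap"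
proof (rule ccontr)
  assume "\<not> ?thesis"
  then have "\<And>a. a \<in> {..<k} \<Longrightarrow> cap \<le> population a"
    by (meson lessThan_iff not_less)
  then have "k * cap \<le> (\<Sum>a<k. population a)"
    using sum_bounded_below[of "{..<k}" cap population] by simp
  also have "\<dots> = card (\<Union>a<k. {i. i < n \<and> slab i = a})"
    unfolding population_def by (rule card_UN_disjoint[symmetric]) auto
  also have "\<dots> \<le> card {..<n}"
    by (rule card_mono) auto
  finally have "k * cap \<le> n" by simp
  moreover have "n < k * cap"
    unfolding k_def using cap_pos by (simp add: dividend_less_div_times)
  ultimately show False by simp
qed

lemma sparse_less: "sparse < k"
  unfolding sparse_def using ex_sparse by (meson Least_le le_less_trans)

lemma population_sparse: "population sparse < cap"
  unfolding sparse_def using ex_sparse by (meson LeastI)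

lemma population_before_sparse: "a < sparse \<Longrightarrow> cap \<le> population a"
  unfolding sparse_def using not_less_Least not_less by blast

lemma population_Suc:
  "card {i'. i' < Suc i \<and> slab i' = a} =
    card {i'. i' < i \<and> slab i' = a} + (if slab i = a then 1 else 0)"
proof -
  have "{i'. i' < Suc i \<and> slab i' = a} =
    (if slab i = a then insert i {i'. i' < i \<and> slab i' = a} else {i'. i' < i \<and> slab i' = a})"
    by (auto simp: less_Suc_eq)
  then show ?thesis by simp
qed

text \<open>Each slab point adds one binary digit; this bounds the range of patterns for the
  pigeonhole argument.\<close>

lemma pattern_less: "pattern i j < 2 ^ card {i'. i' < i \<and> slab i' = sparse}"
  by (induction i) (auto simp: population_Suc)

text \<open>Parity recovers the digit of the latest slab point and halving leaves the earlier
  digits, so equal numerals agree digit by digit.\<close>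

lemma pattern_eqD:
  assumes "pattern i j = pattern i j'" "i' < i" "slab i' = sparse"
  shows "p i' j < threshold j \<longleftrightarrow> p i' j' < threshold j'"
  using assms
proof (induction i)
  case (Suc i)
  show ?case
  proof (cases "slab i = sparse")
    case True
    then have *: "2 * pattern i j + (if p i j < threshold j then 1 else 0) =
        2 * pattern i j' + (if p i j' < threshold j' then 1 else 0)"
      using Suc.prems(1) by simp
    have "pattern i j = pattern i j'" "p i j < threshold j \<longleftrightarrow> p i j' < threshold j'"
      using * by (auto split: if_splits) presburger+
    then show ?thesis using Suc less_Suc_eq by blast
  next
    case False
    then show ?thesis using Suc by (auto simp: less_Suc_eq)
  qed
qed simp

text \<open>Pigeonhole: with fewer than \<open>cap\<close> slab points there are at most
  \<open>2 ^ population sparse\<close> patterns, and minimality of \<open>cap\<close> makes this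
  less than \<open>d\<close>.\<close>

lemma ex_collision: "\<exists>j<d. \<exists>x<j. pattern n x = pattern n j"
proof (rule ccontr)
  assume "\<not> ?thesis"
  then have "inj_on (pattern n) {..<d}"
    by (auto simp: inj_on_def) (metis linorder_neqE_nat)
  moreover have "pattern n ` {..<d} \<subseteq> {..<2 ^ population sparse}"
    using pattern_less[of n] by (auto simp: population_def)
  ultimately have "d \<le> 2 ^ population sparse"
    using card_inj_on_le[of "pattern n" "{..<d}" "{..<2 ^ population sparse}"] by simp
  then show False
    using pow_less_dim[OF population_sparse] by simp
qed

lemma second_less: "second < d"
proof -
  obtain j where "j < d" "\<exists>x<j. pattern n x = pattern n j"
    using ex_collision by blast
  then show ?thesis
    unfolding second_def using Least_le[of "\<lambda>j. \<exists>x<j. pattern n x = pattern n j"]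
    by (meson le_less_trans)
qed

lemma ex_first: "\<exists>x<second. pattern n x = pattern n second"
  unfolding second_def
  by (rule LeastI_ex[of "\<lambda>j. \<exists>x<j. pattern n x = pattern n j"]) (use ex_collision in blast)

lemma no_collision_before:
  "j < second \<Longrightarrow> x < j \<Longrightarrow> pattern n x \<noteq> pattern n j"
  unfolding second_def using not_less_Least by blast

section \<open>Correctness and cost of the individual loops\<close>

definition consts_ok :: "(reg \<Rightarrow> real) \<Rightarrow> bool" where
  "consts_ok r \<longleftrightarrow> r r_n = real n \<and> r r_d = real d \<and> r r_one = 1 \<and>
     r r_zero = 0 \<and> r r_two = 2 \<and> r r_half = 1 / 2"

definition slab_ok :: "(reg \<Rightarrow> real) \<Rightarrow> bool" where
  "slab_ok r \<longleftrightarrow> consts_ok r \<and> r r_k = real k \<and> r r_s = real sparse \<and> r r_base = real (k + 1)"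

text \<open>The facts about \<open>r_i\<close> and \<open>r_s\<close> are carried along because
  \<open>count_loop\<close> and \<open>slab_loop\<close> start from the zeros of the initial state
  in these registers.\<close>

lemma halts_log_loop:
  assumes "consts_ok r" "r r_cap = 0" "r r_pow = 1" "r r_i = 0" "r r_s = 0"
  shows "halts_within n d p log_loop (4 * cap + 1)
    (\<lambda>r' m'. consts_ok r' \<and> r' r_cap = real cap \<and> r' r_i = 0 \<and> r' r_s = 0 \<and> m' = m) r m"
proof -
  let ?I = "\<lambda>i r m'. consts_ok r \<and> r r_cap = real i \<and> r r_pow = real (2 ^ i) \<and>
    r r_i = 0 \<and> r r_s = 0 \<and> m' = m"
  have "halts_within n d p log_loop ((\<Sum>i<cap. 3 + 1) + 1) (?I cap) r m"
    unfolding log_loop_def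
  proof (rule halts_within_While[where I = ?I], goal_cases)
    case 1
    then show ?case using assms by simp
  next
    case (2 i r m)
    then show ?case
      using pow_less_dim[of i]
      by (auto intro!: halts_within_block simp: consts_ok_def)
  next
    case (3 r m)
    then show ?case
      using dim_le_pow_cap by (simp add: consts_ok_def del: of_nat_power)
  qed
  then show ?thesis by (rule halts_within_mono) auto
qed

lemma halts_count_loop:
  assumes "consts_ok r" "r r_cap = real cap" "r r_i = 0" "r r_s = 0" "r r_k = real k"
    "r r_base = real (k + 1)" "m = (\<lambda>_. 0)"
  shows "halts_within n d p count_loop (9 * n + 1)
    (\<lambda>r' m'. consts_ok r' \<and> r' r_cap = real cap \<and> r' r_s = 0 \<and> r' r_k = real k \<and>
      r' r_base = real (k + 1) \<and> m' = (\<lambda>a. real (population a))) r m"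
proof -
  let ?I = "\<lambda>i r m. consts_ok r \<and> r r_cap = real cap \<and> r r_i = real i \<and> r r_s = 0 \<and>
    r r_k = real k \<and> r r_base = real (k + 1) \<and>
    m = (\<lambda>a. real (card {i'. i' < i \<and> slab i' = a}))"
  have "halts_within n d p count_loop ((\<Sum>i<n. 8 + 1) + 1) (?I n) r m"
    unfolding count_loop_def
  proof (rule halts_within_While[where I = ?I], goal_cases)
    case 1
    then show ?case using assms by simp
  next
    case (2 i r m)
    then show ?case
      using dim
      by (auto intro!: halts_within_block
          simp: consts_ok_def real_slab population_Suc fun_eq_iff)
  next
    case (3 r m)
    then show ?case by (simp add: consts_ok_def)
  qed
  then show ?thesis by (rule halts_within_mono) (auto simp: population_def)
qed

lemma halts_slab_loop:
  assumes "consts_ok r" "r r_cap = real cap" "r r_s = 0" "r r_k = real k"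
    "r r_base = real (k + 1)" "r r_v = real (population 0)" "m = (\<lambda>a. real (population a))"
  shows "halts_within n d p slab_loop (4 * sparse + 1)
    (\<lambda>r' m'. slab_ok r' \<and> m' = (\<lambda>a. real (population a))) r m"
proof -
  let ?I = "\<lambda>a r m. consts_ok r \<and> r r_cap = real cap \<and> r r_s = real a \<and>
    r r_k = real k \<and> r r_base = real (k + 1) \<and> r r_v = real (population a) \<and>
    m = (\<lambda>a. real (population a))"
  have "halts_within n d p slab_loop ((\<Sum>i<sparse. 3 + 1) + 1) (?I sparse) r m"
    unfolding slab_loop_def
  proof (rule halts_within_While[where I = ?I], goal_cases)
    case 1
    then show ?case using assms by simp
  next
    case (2 a r m)
    then show ?case
      using population_before_sparse[of a]
      by (auto intro!: halts_within_block simp: consts_ok_def fold_of_nat_add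
          simp del: of_nat_Suc of_nat_add)
  next
    case (3 r m)
    then show ?case using population_sparse by simp
  qed
  then show ?thesis by (rule halts_within_mono) (auto simp: slab_ok_def)
qed

definition stored :: "(nat \<Rightarrow> nat) \<Rightarrow> (nat \<Rightarrow> real) \<Rightarrow> bool" where
  "stored f m \<longleftrightarrow> (\<forall>x<d. m (k + 1 + x) = real (f x))"

definition table_empty :: "(nat \<Rightarrow> real) \<Rightarrow> bool" where
  "table_empty m \<longleftrightarrow> (\<forall>a\<ge>k + 1 + d. m a = 0)"

lemma halts_append_bits_loop:
  assumes "i < n" "slab i = sparse"
    and "slab_ok r" "r r_i = real i" "r r_mid = threshold 0" "r r_j = 0" "r r_thr = threshold 0"
    and "stored (pattern i) m" "table_empty m"
  shows "halts_within n d p append_bits_loop (13 * d + 1)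
    (\<lambda>r' m'. slab_ok r' \<and> r' r_i = real i \<and> r' r_mid = threshold 0 \<and>
      stored (pattern (Suc i)) m' \<and> table_empty m') r m"
proof -
  \<comment> \<open>In the middle of a pass, the cells before \<open>j\<close> already contain the
    digit of point \<open>i\<close> and the others do not yet.\<close>
  let ?I = "\<lambda>j r m. slab_ok r \<and> r r_i = real i \<and> r r_mid = threshold 0 \<and> r r_j = real j \<and>
    r r_thr = threshold j \<and> stored (\<lambda>x. pattern (if x < j then Suc i else i) x) m \<and>
    table_empty m"
  have "halts_within n d p append_bits_loop ((\<Sum>j<d. 12 + 1) + 1) (?I d) r m"
    unfolding append_bits_loop_def
  proof (rule halts_within_While[where I = ?I], goal_cases)
    case 1
    then show ?case using assms by simp
  next
    case (2 j r m)
    then have regs: "slab_ok r" "r r_i = real i" "r r_mid = threshold 0" "r r_j = real j"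
      "r r_thr = threshold j"
      and mem: "stored (\<lambda>x. pattern (if x < j then Suc i else i) x) m" "table_empty m"
      by auto
    let ?R = "\<lambda>v r' m'. slab_ok r' \<and> r' r_i = real i \<and> r' r_mid = threshold 0 \<and>
      r' r_j = real j \<and> r' r_thr = threshold j \<and> r' r_x = p i j \<and>
      r' r_addr = real (k + 1 + j) \<and> r' r_v = real v \<and> m' = m"
    have mj: "m (k + 1 + j) = real (pattern i j)"
      using mem(1) \<open>j < d\<close> by (simp add: stored_def)
    have "halts_within n d p
       (Seq (block [Input r_x r_i r_j, Arith Plus r_addr r_base r_j, Load r_v r_addr,
          Arith Times r_v r_v r_two])
       (Seq (Cond (Less r_x r_thr) (block [Arith Plus r_v r_v r_one]) Skip)
          (block [Store r_addr r_v, Move r_thr r_half, Arith Plus r_j r_j r_one])))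
       (5 + ((1 + 2) + 4)) (?I (Suc j)) r m"
    proof (rule halts_within_Seq[where Q = "?R (2 * pattern i j)"], goal_cases)
      case 1
      show ?case
        using regs \<open>j < d\<close> \<open>i < n\<close> mj
        by (intro halts_within_block)
          (auto simp: slab_ok_def consts_ok_def fold_of_nat_add simp del: of_nat_add of_nat_Suc)
    next
      case (2 r1 m1)
      show ?case
      proof (rule halts_within_Seq[where Q = "?R (pattern (Suc i) j)"], goal_cases)
        case 1
        show ?case
          using 2 \<open>slab i = sparse\<close>
          by (intro halts_within_Cond halts_within_block halts_within_Skip)
            (auto simp: slab_ok_def consts_ok_def)
      next
        case (2 r2 m2)
        have "stored (\<lambda>x. pattern (if x < Suc j then Suc i else i) x)
            (m(k + 1 + j := real (pattern (Suc i) j)))"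
          using mem(1) by (auto simp: stored_def less_Suc_eq)
        moreover have "table_empty (m(k + 1 + j := real (pattern (Suc i) j)))"
          using mem(2) \<open>j < d\<close> by (auto simp: table_empty_def)
        ultimately show ?case
          using 2
          by (intro halts_within_block)
            (auto simp: slab_ok_def consts_ok_def threshold_def
              simp del: of_nat_add of_nat_Suc pattern.simps)
      qed
    qed
    then show ?case using regs \<open>j < d\<close> by (auto simp: slab_ok_def consts_ok_def)
  next
    case (3 r m)
    then show ?case by (simp add: slab_ok_def consts_ok_def)
  qed
  then show ?thesis
    by (rule halts_within_mono) (auto simp: stored_def simp del: pattern.simps)
qed

text \<open>Only points of the sparse slab pay for a pass over all coordinates; every other point
  costs a constant. This keeps the product of \<open>n\<close> and \<open>d\<close> out of the
  running time.\<close>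

lemma halts_pattern_loop:
  assumes "slab_ok r" "r r_i = 0" "r r_mid = threshold 0"
    and "stored (pattern 0) m" "table_empty m"
  shows "halts_within n d p pattern_loop (9 * n + population sparse * (13 * d + 3) + 1)
    (\<lambda>r' m'. slab_ok r' \<and> stored (pattern n) m' \<and> table_empty m') r m"
proof -
  let ?I = "\<lambda>i r m. slab_ok r \<and> r r_i = real i \<and> r r_mid = threshold 0 \<and>
    stored (pattern i) m \<and> table_empty m"
  let ?f = "\<lambda>i. 4 + ((1 + (if slab i = sparse then 13 * d + 4 else 1)) + 2)"
  have "halts_within n d p pattern_loop ((\<Sum>i<n. ?f i + 1) + 1) (?I n) r m"
    unfolding pattern_loop_def
  proof (rule halts_within_While[where I = ?I], goal_cases)
    case 1
    then show ?case using assms by simp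
  next
    case (2 i r m)
    have "halts_within n d p
     (Seq (block [Input r_x r_i r_zero, Arith Times r_x r_k r_x, Floor r_x r_x])
     (Seq (Cond (Equal r_x r_s)
             (Seq (block [Const r_j 0, Move r_thr r_mid]) append_bits_loop) Skip)
          (block [Arith Plus r_i r_i r_one]))) (?f i) (?I (Suc i)) r m"
    proof (rule halts_within_Seq[where Q = "\<lambda>r m. ?I i r m \<and> r r_x = real (slab i)"], goal_cases)
      case 1
      show ?case
        using 2 dim
        by (intro halts_within_block) (auto simp: slab_ok_def consts_ok_def real_slab)
    next
      case (2 r1 m1)
      show ?case
      proof (rule halts_within_Seq[where Q = "\<lambda>r' m'. slab_ok r' \<and> r' r_i = real i \<and>
          r' r_mid = threshold 0 \<and> stored (pattern (Suc i)) m' \<and> table_empty m'"], goal_cases)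
        case 1
        show ?case
        proof (rule halts_within_Cond, goal_cases)
          case 1
          then have i: "slab i = sparse" using 2 by (auto simp: slab_ok_def)
          have "halts_within n d p (Seq (block [Const r_j 0, Move r_thr r_mid]) append_bits_loop)
            (3 + (13 * d + 1)) (\<lambda>r' m'. slab_ok r' \<and> r' r_i = real i \<and>
              r' r_mid = threshold 0 \<and> stored (pattern (Suc i)) m' \<and> table_empty m') r1 m1"
          proof (rule halts_within_Seq[where Q = "\<lambda>r m. ?I i r m \<and> r r_j = 0 \<and>
              r r_thr = threshold 0"], goal_cases)
            case 1
            show ?case
              using 2 by (intro halts_within_block) (auto simp: slab_ok_def consts_ok_def)
          next
            case (2 r m)
            then show ?case
              using i \<open>i < n\<close> by (intro halts_append_bits_loop) auto
          qed
          then show ?case using i by (simp add: add.commute)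
        next
          case 2
          then have "slab i \<noteq> sparse"
            using \<open>?I i r1 m1 \<and> _\<close> by (auto simp: slab_ok_def)
          then show ?case
            using \<open>?I i r1 m1 \<and> _\<close> by (auto intro!: halts_within_Skip simp: stored_def)
        qed
      next
        case (2 r m)
        then show ?case
          by (intro halts_within_block)
            (auto simp: slab_ok_def consts_ok_def simp del: pattern.simps)
      qed
    qed
    then show ?case using 2 by (auto simp: slab_ok_def consts_ok_def)
  next
    case (3 r m)
    then show ?case by (simp add: slab_ok_def consts_ok_def)
  qed
  moreover have "(\<Sum>i<n. ?f i + 1) = 9 * n + population sparse * (13 * d + 3)"
  proof -
    have "(\<Sum>i<n. ?f i + 1) = (\<Sum>i<n. 9 + (if slab i = sparse then 13 * d + 3 else 0))"
      by (intro sum.cong) auto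
    also have "\<dots> = 9 * n + card ({..<n} \<inter> {i. slab i = sparse}) * (13 * d + 3)"
      by (simp add: sum.distrib sum.If_cases)
    also have "{..<n} \<inter> {i. slab i = sparse} = {i. i < n \<and> slab i = sparse}"
      by auto
    finally show ?thesis by (simp add: population_def)
  qed
  ultimately show ?thesis by (auto elim: halts_within_mono)
qed

text \<open>The choice is unique: by \<open>no_collision_before\<close>, coordinates before
  \<open>second\<close> have distinct patterns.\<close>

definition first :: nat where
  "first = (SOME x. x < second \<and> pattern n x = pattern n second)"

lemma first_less: "first < second"
  and pattern_first: "pattern n first = pattern n second"
proof -
  have "first < second \<and> pattern n first = pattern n second"
    unfolding first_def by (rule someI_ex) (use ex_first in blast)
  then show "first < second" "pattern n first = pattern n second" by simp_all
qed

lemma halts_collision_loop: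
  assumes "slab_ok r" "stored (pattern n) m" "table_empty m"
    and "r r_j = 0" "r r_table = real (k + 1 + d)" "r r_v = real (k + 1 + d + pattern n 0)"
    and "r r_x = 0"
  shows "halts_within n d p collision_loop (8 * d + 1)
    (\<lambda>r' m'. slab_ok r' \<and> r' r_j = real second \<and> r' r_x = real (first + 1)) r m"
proof -
  let ?t = "\<lambda>x. k + 1 + d + pattern n x"
  \<comment> \<open>The last conjunct says that every nonzero table entry was written for an earlier
    coordinate, so a nonzero lookup really is a collision.\<close>
  let ?I = "\<lambda>j r m. slab_ok r \<and> r r_j = real j \<and> r r_table = real (k + 1 + d) \<and>
    r r_v = real (?t j) \<and> r r_x = m (?t j) \<and> stored (pattern n) m \<and>
    (\<forall>x<j. m (?t x) = real (x + 1)) \<and>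
    (\<forall>a\<ge>k + 1 + d. m a \<noteq> 0 \<longrightarrow> (\<exists>x<j. a = ?t x))"
  \<comment> \<open>At \<open>second\<close> the lookup reads the entry written for
    \<open>first\<close>, which is nonzero because of the added one; this both stops the loop and
    identifies \<open>first\<close>.\<close>
  have exit: "v = real (first + 1)"
    if "v = m (?t second)" "\<forall>x<second. m (?t x) = real (x + 1)" for v m
  proof -
    have "m (?t first) = real (first + 1)" using that(2) first_less by blast
    then show ?thesis using that(1) pattern_first by simp
  qed
  have "halts_within n d p collision_loop ((\<Sum>j<second. 7 + 1) + 1) (?I second) r m"
    unfolding collision_loop_def
  proof (rule halts_within_While[where I = ?I], goal_cases)
    case 1
    then show ?case using assms by (auto simp: table_empty_def)
  next
    case (2 j r m)
    define m1 where "m1 = m(?t j := real (j + 1))"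
    then have fold_m1: "m(Suc (k + d + pattern n j) := real (Suc j)) = m1" by simp
    have "Suc j < d" using 2 second_less by simp
    \<comment> \<open>A nonzero entry would come from some \<open>x < j\<close> with the same
      pattern, contradicting the minimality of \<open>second\<close>.\<close>
    have zero: "r r_x = 0"
      using 2 no_collision_before[of j] by (metis add_left_cancel le_add1)
    have stored: "stored (pattern n) m1"
      using 2 by (auto simp: stored_def m1_def)
    then have v: "m1 (k + 1 + Suc j) = real (pattern n (Suc j))"
      using \<open>Suc j < d\<close> unfolding stored_def by blast
    have 1: "\<forall>x<Suc j. m1 (?t x) = real (x + 1)"
      using 2 no_collision_before[of j] by (auto simp: less_Suc_eq m1_def)
    have 3: "\<forall>a\<ge>k + 1 + d. m1 a \<noteq> 0 \<longrightarrow> (\<exists>x<Suc j. a = ?t x)"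
      using 2 by (auto simp: less_Suc_eq m1_def)
    have "wp n d p ([Arith Plus r_j r_j r_one, Store r_v r_j] @ lookup) (?I (Suc j)) r m"
      using 2 stored v 1 3
      by (simp add: lookup_def slab_ok_def consts_ok_def fold_of_nat_add fold_m1
          del: of_nat_add of_nat_Suc)
    moreover have "test_val (Equal r_x r_zero) r"
      using 2 zero by (simp add: slab_ok_def consts_ok_def)
    ultimately show ?case
      by (intro conjI halts_within_block) (simp_all only:, simp add: lookup_def)
  next
    case (3 r m)
    then have "slab_ok r \<and> r r_x = m (?t second) \<and> (\<forall>x<second. m (?t x) = real (x + 1))"
      by - (elim conjE, intro conjI; assumption)
    then show ?case using exit[of "r r_x" m] by (simp add: slab_ok_def consts_ok_def)
  qed
  then show ?thesis
  proof (rule halts_within_mono)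
    show "(\<Sum>j<second. 7 + 1) + 1 \<le> 8 * d + 1" using second_less by simp
  qed (elim conjE, intro conjI exit; assumption)
qed

text \<open>The work data in memory may be overwritten, since the remaining steps use only registers
  and the output cells themselves.\<close>

lemma halts_output_loop:
  assumes "consts_ok r" "r r_j = real second" "r r_first = real first" "r r_i = 0" "r r_addr = 0"
    "r r_lo = lower 0" "r r_hi = upper 0"
  shows "halts_within n d p output_loop (9 * d + 1)
    (\<lambda>r' m'. consts_ok r' \<and> r' r_j = real second \<and> r' r_first = real first \<and>
      (\<forall>x<d. m' (2 * x) = lower x \<and> m' (2 * x + 1) = upper x)) r m"
proof -
  let ?I = "\<lambda>t r m. consts_ok r \<and> r r_j = real second \<and> r r_first = real first \<and> r r_i = real t \<and>
    r r_addr = real (2 * t) \<and> r r_lo = lower t \<and> r r_hi = upper t \<and>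
    (\<forall>x<t. m (2 * x) = lower x \<and> m (2 * x + 1) = upper x)"
  have "halts_within n d p output_loop ((\<Sum>t<d. 8 + 1) + 1) (?I d) r m"
    unfolding output_loop_def
  proof (rule halts_within_While[where I = ?I], goal_cases)
    case 1
    then show ?case using assms by simp
  next
    case (2 t r m)
    have addr: "real (2 * t) + 1 = real (2 * t + 1)" "real (2 * t + 1) + 1 = real (2 * Suc t)"
      by simp_all
    have "wp n d p [Store r_addr r_lo, Arith Plus r_addr r_addr r_one, Store r_addr r_hi,
        Arith Plus r_addr r_addr r_one, Const r_lo 0, Const r_hi 1, Arith Plus r_i r_i r_one]
        (?I (Suc t)) r m"
      using 2
      by (auto simp: consts_ok_def addr lower_def upper_def less_Suc_eq
          simp del: of_nat_add of_nat_mult)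
    then show ?case
      using 2 by (auto intro!: halts_within_block simp: consts_ok_def)
  next
    case (3 r m)
    then show ?case by (simp add: consts_ok_def)
  qed
  then show ?thesis by (rule halts_within_mono) auto
qed

section \<open>The assembled program\<close>

definition box_lower :: "nat \<Rightarrow> real" where
  "box_lower x = (if x = second then 1 / 2 else lower x)"

text \<open>The midpoint is needed in this form because \<open>first\<close> may be 0. In
  \<open>box_lower\<close> the constant \<open>1 / 2\<close> suffices: \<open>second\<close> exceeds
  \<open>first\<close>, so it is never coordinate 0.\<close>

definition box_upper :: "nat \<Rightarrow> real" where
  "box_upper x = (if x = first then (lower x + upper x) / 2 else upper x)"

text \<open>The time bound is nested exactly like the \<open>Seq\<close> structure of the program,
  so that \<open>halts_within_Seq\<close> unifies with it.\<close>

lemma halts_algorithm: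
  assumes "r = (\<lambda>_. 0)(0 := real n, 1 := real d)" "m = (\<lambda>_. 0)"
  shows "halts_within n d p algorithm
    (5 + ((4 * cap + 1) + (5 + ((9 * n + 1) + (2 + ((4 * sparse + 1) + (4 +
      ((9 * n + population sparse * (13 * d + 3) + 1) + (7 + ((8 * d + 1) + (7 +
      ((9 * d + 1) + 10))))))))))))
    (\<lambda>r' m'. \<forall>x<d. m' (2 * x) = box_lower x \<and> m' (2 * x + 1) = box_upper x) r m"
proof -
  have init: "halts_within n d p
      (block [Const r_one 1, Const r_two 2, Const r_pow 1, Arith Divide r_half r_one r_two]) 5
      (\<lambda>r' m'. consts_ok r' \<and> r' r_cap = 0 \<and> r' r_pow = 1 \<and> r' r_i = 0 \<and> r' r_s = 0 \<and>
        m' = (\<lambda>_. 0)) r m"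
    using assms by (intro halts_within_block) (auto simp: consts_ok_def)
  have log: "halts_within n d p log_loop (4 * cap + 1)
      (\<lambda>r' m'. consts_ok r' \<and> r' r_cap = real cap \<and> r' r_i = 0 \<and> r' r_s = 0 \<and>
        m' = (\<lambda>_. 0)) r m"
    if "consts_ok r \<and> r r_cap = 0 \<and> r r_pow = 1 \<and> r r_i = 0 \<and> r r_s = 0 \<and> m = (\<lambda>_. 0)"
    for r m
    by (rule halts_within_mono[OF halts_log_loop]) (use that in auto)
  have slabs: "halts_within n d p
      (block [Arith Divide r_k r_n r_cap, Floor r_k r_k, Arith Plus r_k r_k r_one,
        Arith Plus r_base r_k r_one]) 5
      (\<lambda>r' m'. consts_ok r' \<and> r' r_cap = real cap \<and> r' r_i = 0 \<and> r' r_s = 0 \<and>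
        r' r_k = real k \<and> r' r_base = real (k + 1) \<and> m' = (\<lambda>_. 0)) r m"
    if "consts_ok r \<and> r r_cap = real cap \<and> r r_i = 0 \<and> r r_s = 0 \<and> m = (\<lambda>_. 0)" for r m
    using that cap_pos
    by (intro halts_within_block) (auto simp: consts_ok_def k_def floor_divide_of_nat_eq)
  have count: "halts_within n d p count_loop (9 * n + 1)
      (\<lambda>r' m'. consts_ok r' \<and> r' r_cap = real cap \<and> r' r_s = 0 \<and> r' r_k = real k \<and>
        r' r_base = real (k + 1) \<and> m' = (\<lambda>a. real (population a))) r m"
    if "consts_ok r \<and> r r_cap = real cap \<and> r r_i = 0 \<and> r r_s = 0 \<and>
        r r_k = real k \<and> r r_base = real (k + 1) \<and> m = (\<lambda>_. 0)" for r m
    using that by (intro halts_count_loop) auto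
  have load: "halts_within n d p (block [Load r_v r_zero]) 2
      (\<lambda>r' m'. consts_ok r' \<and> r' r_cap = real cap \<and> r' r_s = 0 \<and> r' r_k = real k \<and>
        r' r_base = real (k + 1) \<and> r' r_v = real (population 0) \<and>
        m' = (\<lambda>a. real (population a))) r m"
    if "consts_ok r \<and> r r_cap = real cap \<and> r r_s = 0 \<and> r r_k = real k \<and>
        r r_base = real (k + 1) \<and> m = (\<lambda>a. real (population a))" for r m
    using that by (intro halts_within_block) (auto simp: consts_ok_def)
  have slab: "halts_within n d p slab_loop (4 * sparse + 1)
      (\<lambda>r' m'. slab_ok r' \<and> m' = (\<lambda>a. real (population a))) r m"
    if "consts_ok r \<and> r r_cap = real cap \<and> r r_s = 0 \<and> r r_k = real k \<and>
        r r_base = real (k + 1) \<and> r r_v = real (population 0) \<and>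
        m = (\<lambda>a. real (population a))" for r m
    using that by (intro halts_slab_loop) auto
  \<comment> \<open>The cells above index \<open>k\<close> hold populations of nonexistent slabs,
    hence zeros. They serve as the initial patterns and as the empty table, without any
    clearing.\<close>
  have mid: "halts_within n d p
      (block [Arith Plus r_mid r_s r_half, Arith Divide r_mid r_mid r_k, Const r_i 0]) 4
      (\<lambda>r' m'. slab_ok r' \<and> r' r_i = 0 \<and> r' r_mid = threshold 0 \<and>
        stored (pattern 0) m' \<and> table_empty m') r m"
    if "slab_ok r \<and> m = (\<lambda>a. real (population a))" for r m
    using that k_pos
    by (intro halts_within_block)
      (auto simp: slab_ok_def consts_ok_def threshold_def stored_def table_empty_def
        population_eq_0)
  have patterns: "halts_within n d p pattern_loop
      (9 * n + population sparse * (13 * d + 3) + 1)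
      (\<lambda>r' m'. slab_ok r' \<and> stored (pattern n) m' \<and> table_empty m') r m"
    if "slab_ok r \<and> r r_i = 0 \<and> r r_mid = threshold 0 \<and> stored (pattern 0) m \<and> table_empty m"
    for r m
    using that by (intro halts_pattern_loop) auto
  have table: "halts_within n d p (block ([Const r_j 0, Arith Plus r_table r_base r_d] @ lookup)) 7
      (\<lambda>r' m'. slab_ok r' \<and> stored (pattern n) m' \<and> table_empty m' \<and> r' r_j = 0 \<and>
        r' r_table = real (k + 1 + d) \<and> r' r_v = real (k + 1 + d + pattern n 0) \<and>
        r' r_x = 0) r m"
    if "slab_ok r \<and> stored (pattern n) m \<and> table_empty m" for r m
  proof (rule halts_within_block)
    have "m (Suc k) = real (pattern n 0)"
      using that dim by (auto simp: stored_def dest: spec[of _ 0])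
    moreover have "m (Suc (k + d + pattern n 0)) = 0"
      using that by (simp add: table_empty_def)
    ultimately show "wp n d p ([Const r_j 0, Arith Plus r_table r_base r_d] @ lookup)
      (\<lambda>r' m'. slab_ok r' \<and> stored (pattern n) m' \<and> table_empty m' \<and> r' r_j = 0 \<and>
        r' r_table = real (k + 1 + d) \<and> r' r_v = real (k + 1 + d + pattern n 0) \<and>
        r' r_x = 0) r m"
      using that
      by (simp add: lookup_def slab_ok_def consts_ok_def fold_of_nat_add
          del: of_nat_add of_nat_Suc)
  qed (simp add: lookup_def)
  have collision: "halts_within n d p collision_loop (8 * d + 1)
      (\<lambda>r' m'. slab_ok r' \<and> r' r_j = real second \<and> r' r_x = real (first + 1)) r m"
    if "slab_ok r \<and> stored (pattern n) m \<and> table_empty m \<and> r r_j = 0 \<and>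
        r r_table = real (k + 1 + d) \<and> r r_v = real (k + 1 + d + pattern n 0) \<and>
        r r_x = 0" for r m
    using that by (intro halts_collision_loop) auto
  have corners: "halts_within n d p
      (block [Arith Minus r_first r_x r_one, Arith Divide r_lo r_s r_k,
        Arith Plus r_hi r_s r_one, Arith Divide r_hi r_hi r_k, Const r_i 0, Const r_addr 0]) 7
      (\<lambda>r' m'. consts_ok r' \<and> r' r_j = real second \<and> r' r_first = real first \<and> r' r_i = 0 \<and>
        r' r_addr = 0 \<and> r' r_lo = lower 0 \<and> r' r_hi = upper 0) r m"
    if "slab_ok r \<and> r r_j = real second \<and> r r_x = real (first + 1)" for r m
    using that k_pos
    by (intro halts_within_block) (auto simp: slab_ok_def consts_ok_def lower_def upper_def)
  have "output": "halts_within n d p output_loop (9 * d + 1)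
      (\<lambda>r' m'. consts_ok r' \<and> r' r_j = real second \<and> r' r_first = real first \<and>
        (\<forall>x<d. m' (2 * x) = lower x \<and> m' (2 * x + 1) = upper x)) r m"
    if "consts_ok r \<and> r r_j = real second \<and> r r_first = real first \<and> r r_i = 0 \<and>
        r r_addr = 0 \<and> r r_lo = lower 0 \<and> r r_hi = upper 0" for r m
    using that by (intro halts_output_loop) auto
  have halve: "halts_within n d p
      (block [Arith Times r_addr r_first r_two, Load r_x r_addr,
        Arith Plus r_addr r_addr r_one, Load r_v r_addr, Arith Plus r_x r_x r_v,
        Arith Divide r_x r_x r_two, Store r_addr r_x,
        Arith Times r_addr r_j r_two, Store r_addr r_half]) 10
      (\<lambda>r' m'. \<forall>x<d. m' (2 * x) = box_lower x \<and> m' (2 * x + 1) = box_upper x) r m"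
    if "consts_ok r \<and> r r_j = real second \<and> r r_first = real first \<and>
        (\<forall>x<d. m (2 * x) = lower x \<and> m (2 * x + 1) = upper x)" for r m
  proof (rule halts_within_block)
    define m1 where
      "m1 = m(2 * first + 1 := (lower first + upper first) / 2, 2 * second := 1 / 2)"
    have m_first: "m (2 * first) = lower first" "m (Suc (2 * first)) = upper first"
      using that first_less second_less by auto
    have m_box: "\<forall>x<d. m1 (2 * x) = box_lower x \<and> m1 (2 * x + 1) = box_upper x"
    proof (intro allI impI)
      fix x assume "x < d"
      \<comment> \<open>Lower ends occupy even cells and upper ends odd ones, so the two final
        writes cannot interfere.\<close>
      have "2 * x \<noteq> 2 * first + 1" "2 * x + 1 \<noteq> 2 * second" by presburger+
      then show "m1 (2 * x) = box_lower x \<and> m1 (2 * x + 1) = box_upper x"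
        using that \<open>x < d\<close> by (auto simp: box_lower_def box_upper_def m1_def)
    qed
    have fold_m1: "m(Suc (2 * first) := (lower first + upper first) / 2,
        2 * second := r r_half) = m1"
      using that by (simp only: m1_def consts_ok_def Suc_eq_plus1)
    have fold: "real x * 2 = real (2 * x)" for x by simp
    show "wp n d p [Arith Times r_addr r_first r_two, Load r_x r_addr,
        Arith Plus r_addr r_addr r_one, Load r_v r_addr, Arith Plus r_x r_x r_v,
        Arith Divide r_x r_x r_two, Store r_addr r_x,
        Arith Times r_addr r_j r_two, Store r_addr r_half]
      (\<lambda>r' m'. \<forall>x<d. m' (2 * x) = box_lower x \<and> m' (2 * x + 1) = box_upper x) r m"
      using that m_first m_box
      by (simp add: consts_ok_def fold fold_of_nat_add fold_m1
          del: of_nat_add of_nat_Suc of_nat_mult)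
  qed simp
  \<comment> \<open>Each fact above takes its precondition as one conjunction, matching the
    postcondition of the previous fact, so the facts chain by \<open>erule\<close>.\<close>
  show ?thesis
    unfolding algorithm_def
    by (rule halts_within_Seq, rule init, rule halts_within_Seq, erule log,
        rule halts_within_Seq, erule slabs, rule halts_within_Seq, erule count,
        rule halts_within_Seq, erule load, rule halts_within_Seq, erule slab,
        rule halts_within_Seq, erule mid, rule halts_within_Seq, erule patterns,
        rule halts_within_Seq, erule table, rule halts_within_Seq, erule collision,
        rule halts_within_Seq, erule corners, rule halts_within_Seq, erule "output",
        erule halve)
qed

section \<open>Running time\<close>

lemma running_time:
  "real (5 + ((4 * cap + 1) + (5 + ((9 * n + 1) + (2 + ((4 * sparse + 1) + (4 +
      ((9 * n + population sparse * (13 * d + 3) + 1) + (7 + ((8 * d + 1) + (7 +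
      ((9 * d + 1) + 10)))))))))))) \<le> 60 * (real n + real d * log 2 (real d))"
proof -
  let ?L = "log 2 (real d)"
  have "1 \<le> ?L" using dim by simp
  then have dL: "real d \<le> real d * ?L" by (simp add: mult_le_cancel_left1)
  have "real (population sparse) \<le> real cap - 1"
    using population_sparse by linarith
  then have "real (population sparse) \<le> ?L" using cap_less by linarith
  then have "real (population sparse) * (13 * real d + 3) \<le> ?L * (13 * real d + 3)"
    by (intro mult_right_mono) auto
  \<comment> \<open>Here \<open>d \<ge> 2\<close> gives \<open>3 \<le> 2 * d\<close>.\<close>
  also have "\<dots> \<le> ?L * (15 * real d)"
    using \<open>1 \<le> ?L\<close> dim by (intro mult_left_mono) auto
  finally have pop: "real (population sparse) * (13 * real d + 3) \<le> 15 * (real d * ?L)"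
    by (simp add: mult_ac)
  have "real cap \<le> real d" "real sparse \<le> real n" "2 \<le> real d" "0 \<le> real n"
    using cap_le sparse_less k_le dim by linarith+
  \<comment> \<open>Bounding 46 by \<open>23 * d\<close>, \<open>cap\<close> by \<open>d\<close> and
    \<open>sparse\<close> by \<open>n\<close> leaves at most \<open>22 * n + 59 * D\<close>.\<close>
  then have "46 + 18 * real n + 4 * real cap + 4 * real sparse + 17 * real d + P
      \<le> 60 * real n + 60 * D"
    if "real d \<le> D" "P \<le> 15 * D" for D P
    using that by argo
  from this[OF dL pop] show ?thesis by simp
qed

section \<open>Shape, emptiness and volume of the box\<close>

lemma lower_less_upper: "lower i < upper i"
  using k_pos by (simp add: lower_def upper_def divide_strict_right_mono)

text \<open>Since \<open>first\<close> and \<open>second\<close> differ, no interval is cut at both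
  ends.\<close>

lemma box_lower_less_box_upper: "box_lower i < box_upper i"
  using lower_less_upper[of i] first_less
  by (auto simp: box_lower_def box_upper_def lower_def upper_def)

lemma box_lower_nonneg: "0 \<le> box_lower i"
  by (simp add: box_lower_def lower_def)

lemma box_upper_le_1: "box_upper i \<le> 1"
proof -
  have "upper i \<le> 1"
    using sparse_less by (simp add: upper_def)
  then show ?thesis using lower_less_upper[of i] by (auto simp: box_upper_def)
qed

lemma threshold_first: "threshold first = (lower first + upper first) / 2"
  by (simp add: threshold_def lower_def upper_def add_divide_distrib)

text \<open>A point of the box would lie in the sparse slab, below the middle in
  \<open>first\<close> and above it in \<open>second\<close>, although its digits in these two
  coordinates agree.\<close>

lemma box_avoids_points:
  assumes "i < n"
  shows "p i \<notin> open_box d box_lower box_upper"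
proof
  assume "p i \<in> open_box d box_lower box_upper"
  then have "p i j \<in> {box_lower j<..<box_upper j}" if "j < d" for j
    unfolding open_box_def by (rule PiE_mem) (simp add: that)
  then have box: "box_lower j < p i j" "p i j < box_upper j" if "j < d" for j
    using that by simp_all
  \<comment> \<open>If \<open>first = 0\<close>, the upper end is the midpoint, which is still below
    \<open>upper 0\<close>; and \<open>second\<close> is not 0.\<close>
  have "lower 0 < p i 0" "p i 0 < upper 0"
    using box[of 0] dim first_less lower_less_upper[of 0]
    by (auto simp: box_lower_def box_upper_def split: if_splits)
  then have "real sparse < real k * p i 0" "real k * p i 0 < real sparse + 1"
    using k_pos by (auto simp: lower_def upper_def field_simps)
  then have "slab i = sparse"
    unfolding slab_def by linarith
  then have "p i first < threshold first \<longleftrightarrow> p i second < threshold second"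
    using pattern_eqD[OF pattern_first assms] by simp
  moreover have "p i first < threshold first"
    using box[of first] first_less second_less
    by (simp add: threshold_first box_upper_def)
  moreover have "\<not> p i second < threshold second"
    using box[of second] first_less second_less
    by (simp add: threshold_def box_lower_def)
  ultimately show False by simp
qed

lemma prod_box: "(\<Prod>i<d. box_upper i - box_lower i) = 1 / (4 * real k)"
proof -
  \<comment> \<open>Three separate factors, because \<open>first\<close> may coincide with 0, in
    which case that side length is \<open>1 / (2 * k)\<close>.\<close>
  have "box_upper i - box_lower i = (if i = 0 then 1 / real k else 1) *
      ((if i = first then 1 / 2 else 1) * (if i = second then 1 / 2 else 1))" for i
    using first_less k_pos
    by (auto simp: box_upper_def box_lower_def upper_def lower_def field_simps)
  then have "(\<Prod>i<d. box_upper i - box_lower i) =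
      (\<Prod>i<d. if i = 0 then 1 / real k else 1) *
      ((\<Prod>i<d. if i = first then 1 / 2 else 1) * (\<Prod>i<d. if i = second then 1 / 2 else 1))"
    by (simp add: prod.distrib)
  then show ?thesis using dim first_less second_less by simp
qed

text \<open>With \<open>L = log 2 d \<le> cap\<close>, the number of slabs satisfies
  \<open>k \<le> n / cap + 1 \<le> (n + L) / L\<close>.\<close>

lemma volume_bound:
  "log 2 (real d) / (4 * (real n + log 2 (real d))) \<le> 1 / (4 * real k)"
proof -
  let ?L = "log 2 (real d)"
  have L: "1 \<le> ?L" using dim by simp
  have "real (n div cap) \<le> real n / real cap"
    by (rule of_nat_div_le_of_nat)
  also have "\<dots> \<le> real n / ?L"
    using L log_le_cap by (intro divide_left_mono) auto
  finally have "real k \<le> (real n + ?L) / ?L"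
    unfolding k_def using L by (simp add: add_divide_distrib)
  then have "real k * ?L \<le> real n + ?L"
    using L by (simp add: pos_le_divide_eq)
  then show ?thesis using L k_pos by (simp add: divide_simps mult_ac)
qed

end

theorem theorem1:
  "\<exists>(A :: program) (C :: real). C > 0 \<and>
     (\<forall>(d :: nat) (n :: nat) (S :: point set) (p :: nat \<Rightarrow> point).
        d \<ge> 2 \<longrightarrow> S \<subseteq> unit_cube d \<longrightarrow> bij_betw p {..<n} S \<longrightarrow>
        (\<exists>(t :: nat) (s :: state).
           exec n d p A (init_state n d) t s \<and>
           real t \<le> C * (real n + real d * log 2 (real d)) \<and>
           empty_box d S (output_lower s) (output_upper s) \<and>
           box_volume d (open_box d (output_lower s) (output_upper s))
             \<ge> log 2 (real d) / (4 * (real n + log 2 (real d)))))"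
proof (intro exI[of _ algorithm] exI[of _ "60 :: real"] conjI allI impI)
  fix d n :: nat and S :: "point set" and p :: "nat \<Rightarrow> point"
  assume d: "d \<ge> 2" and S: "S \<subseteq> unit_cube d" and bij: "bij_betw p {..<n} S"
  have S_eq: "S = p ` {..<n}" using bij by (simp add: bij_betw_def)
  have "p i j \<in> {0..1}" if "i < n" "j < d" for i j
    using S that by (intro PiE_mem[of "p i" "{..<d}"]) (auto simp: S_eq unit_cube_def)
  then interpret points_in_cube n d p
    using d by unfold_locales simp_all
  obtain t r m where run: "exec n d p algorithm (init_state n d) t (r, m)"
    and t: "real t \<le> 60 * (real n + real d * log 2 (real d))"
    and m: "\<forall>x<d. m (2 * x) = box_lower x \<and> m (2 * x + 1) = box_upper x"
    using halts_algorithm[OF refl refl] running_time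
    unfolding halts_within_def init_state_def by (meson of_nat_le_iff order_trans)
  let ?a = "output_lower (r, m)" and ?b = "output_upper (r, m)"
  have ab: "?a i = box_lower i" "?b i = box_upper i" if "i < d" for i
    using m that by (simp_all add: output_lower_def output_upper_def)
  \<comment> \<open>The output is known only for coordinates below \<open>d\<close>, and
    \<open>open_box d\<close> looks at no others.\<close>
  have box: "open_box d ?a ?b = open_box d box_lower box_upper"
    unfolding open_box_def using ab by (intro PiE_cong) simp
  have "open_box d box_lower box_upper \<subseteq> unit_cube d"
    unfolding open_box_def unit_cube_def
  proof (rule PiE_mono)
    show "{box_lower i<..<box_upper i} \<subseteq> {0..1}" for i
      using box_lower_nonneg[of i] box_upper_le_1[of i] by auto
  qed
  then have "empty_box d S ?a ?b"
    unfolding empty_box_def box S_eq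
    using ab box_lower_less_box_upper box_avoids_points by auto
  moreover have "log 2 (real d) / (4 * (real n + log 2 (real d))) \<le> box_volume d (open_box d ?a ?b)"
    unfolding box
    using box_lower_less_box_upper volume_bound
    by (simp add: box_volume_open_box less_imp_le prod_box)
  ultimately show "\<exists>t s. exec n d p algorithm (init_state n d) t s \<and>
      real t \<le> 60 * (real n + real d * log 2 (real d)) \<and>
      empty_box d S (output_lower s) (output_upper s) \<and>
      log 2 (real d) / (4 * (real n + log 2 (real d)))
        \<le> box_volume d (open_box d (output_lower s) (output_upper s))"
    using run t by blast
qed simp

end
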